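(* For each integer $r\ge 3$, every properly coloured $K_r$-free graph $G$ of chromatic number $\chi$ contains a rainbow independent set of size $\lceil\frac12\chi^{1/(r-2)}\rceil$.
   Context: Graphs are finite and simple. A graph is $K_r$-free if it contains no clique on $r$ vertices. A proper colouring assigns colours to vertices so that adjacent vertices receive distinct colours. Given a proper colouring, a set of vertices is rainbow if all its vertices receive pairwise distinct colours. *)

theory Defs
  imports Complex_Main "HOL-Library.Ramsey"
begin

text \<open>
  A graph is a vertex set \<open>V\<close> with a set \<open>E\<close> of two-element subsets of \<open>V\<close>. Cliques and
  independent sets are \<^const>\<open>clique\<close> and \<^const>\<open>indep\<close> from \<^theory>\<open>HOL-Library.Ramsey\<close>,
  whose first argument is the vertex subset in question and whose second is the edge set.
\<close>

definition simple_graph :: "'a set \<Rightarrow> 'a set set \<Rightarrow> bool" where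
  "simple_graph V E \<longleftrightarrow> finite V \<and> E \<subseteq> [V]\<^bsup>2\<^esup>"

definition clique_free :: "nat \<Rightarrow> 'a set \<Rightarrow> 'a set set \<Rightarrow> bool" where
  "clique_free r V E \<longleftrightarrow> \<not> (\<exists>K \<subseteq> V. card K = r \<and> clique K E)"

definition proper_colouring :: "'a set \<Rightarrow> 'a set set \<Rightarrow> ('a \<Rightarrow> 'c) \<Rightarrow> bool" where
  "proper_colouring V E c \<longleftrightarrow> (\<forall>u\<in>V. \<forall>v\<in>V. {u, v} \<in> E \<longrightarrow> c u \<noteq> c v)"

definition chromatic_number :: "'a set \<Rightarrow> 'a set set \<Rightarrow> nat" where
  "chromatic_number V E =
     (LEAST k. \<exists>c :: 'a \<Rightarrow> nat. proper_colouring V E c \<and> c ` V \<subseteq> {..<k})"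

definition rainbow :: "('a \<Rightarrow> 'c) \<Rightarrow> 'a set \<Rightarrow> bool" where
  "rainbow c S \<longleftrightarrow> inj_on c S"

text \<open>The minimum in \<^const>\<open>chromatic_number\<close> is attained for every simple graph.\<close>

lemma chromatic_number_attained:
  assumes "simple_graph V E"
  shows "\<exists>c :: 'a \<Rightarrow> nat. proper_colouring V E c \<and> c ` V \<subseteq> {..<chromatic_number V E}"
proof -
  from assms have "finite V" and E: "E \<subseteq> [V]\<^bsup>2\<^esup>"
    by (auto simp: simple_graph_def)
  then obtain c :: "'a \<Rightarrow> nat" where c: "c ` V = {..<card V}" "inj_on c V"
    by (metis atLeast0LessThan bij_betw_def ex_bij_betw_finite_nat)
  have "proper_colouring V E c"
    unfolding proper_colouring_def
  proof (intro ballI impI notI)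
    fix u v assume uv: "u \<in> V" "v \<in> V" "{u, v} \<in> E" "c u = c v"
    then have "u = v" using c(2) by (auto dest: inj_onD)
    with uv(3) E show False by (auto simp: nsets_def)
  qed
  with c(1) have "\<exists>k. \<exists>c :: 'a \<Rightarrow> nat. proper_colouring V E c \<and> c ` V \<subseteq> {..<k}"
    by blast
  then show ?thesis
    unfolding chromatic_number_def by (rule LeastI_ex)
qed

end

theory Submission
  imports Defs
begin

text \<open>
  Let \<open>t\<close> be the largest size of a rainbow independent set and let \<open>S\<close> be a rainbow independent
  set of that size. By maximality every vertex whose colour is not used on \<open>S\<close> has a neighbour in
  \<open>S\<close>. So \<open>G\<close> is covered by the \<open>t\<close> colour classes meeting \<open>S\<close> and by \<open>t\<close> neighbourhoods,
  which are \<open>K\<^bsub>r-1\<^esub>\<close>-free. Inductively these have chromatic number at most \<open>(2t)^(r-3)\<close>, whence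
  \<open>\<chi> \<le> t + t (2t)^(r-3) \<le> (2t)^(r-2)\<close>.
\<close>

text \<open>Unlike the minimum in \<open>chromatic_number\<close>, this predicate passes directly to
  unions and subsets.\<close>

definition colourable :: "nat \<Rightarrow> 'a set \<Rightarrow> 'a set set \<Rightarrow> bool" where
  "colourable k V E \<longleftrightarrow> (\<exists>c :: 'a \<Rightarrow> nat. proper_colouring V E c \<and> c ` V \<subseteq> {..<k})"

lemma proper_colouring_subset:
  "proper_colouring V E c \<Longrightarrow> W \<subseteq> V \<Longrightarrow> proper_colouring W E c"
  by (auto simp: proper_colouring_def)

lemma clique_free_subset: "clique_free r V E \<Longrightarrow> W \<subseteq> V \<Longrightarrow> clique_free r W E"
  unfolding clique_free_def by blast

lemma chromatic_number_le: "colourable k V E \<Longrightarrow> chromatic_number V E \<le> k"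
  unfolding chromatic_number_def colourable_def by (rule Least_le)

lemma colourable_mono:
  assumes "colourable k V E" "k \<le> l" "W \<subseteq> V"
  shows "colourable l W E"
  using assms proper_colouring_subset[OF _ assms(3)] unfolding colourable_def
  by (meson image_mono lessThan_subset_iff subset_trans)

lemma colourable_Un:
  assumes "colourable a A E" "colourable b B E"
  shows "colourable (a + b) (A \<union> B) E"
proof -
  obtain f g :: "'a \<Rightarrow> nat"
    where f: "proper_colouring A E f" "f ` A \<subseteq> {..<a}"
      and g: "proper_colouring B E g" "g ` B \<subseteq> {..<b}"
    using assms unfolding colourable_def by blast
  \<comment> \<open>The palettes are made disjoint by shifting \<open>g\<close> past
    \<open>a\<close>; \<open>f\<close> takes precedence on the overlap of \<open>A\<close> and
    \<open>B\<close>.\<close>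
  define h where "h x = (if x \<in> A then f x else a + g x)" for x
  have fa: "f x < a" if "x \<in> A" for x
    using f(2) that by auto
  have "proper_colouring (A \<union> B) E h"
    unfolding proper_colouring_def
  proof (intro ballI impI)
    fix u v assume uv: "u \<in> A \<union> B" "v \<in> A \<union> B" "{u, v} \<in> E"
    then show "h u \<noteq> h v"
      using f(1) g(1) fa[of u] fa[of v] by (auto simp: h_def proper_colouring_def)
  qed
  moreover have "h ` (A \<union> B) \<subseteq> {..<a + b}"
    using f(2) g(2) by (force simp: h_def)
  ultimately show ?thesis
    unfolding colourable_def by blast
qed

lemma colourable_UN:
  assumes "finite I" "\<And>i. i \<in> I \<Longrightarrow> colourable m (A i) E"
  shows "colourable (card I * m) (\<Union>i\<in>I. A i) E"
  using assms
proof (induction I rule: finite_induct)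
  case empty
  show ?case by (simp add: colourable_def proper_colouring_def)
next
  case (insert i I)
  then have "colourable (m + card I * m) (A i \<union> (\<Union>i\<in>I. A i)) E"
    by (intro colourable_Un) auto
  with insert show ?case by simp
qed

text \<open>Properness of \<open>c\<close> leaves no edge inside a monochromatic set, so a constant
  colouring is proper there.\<close>

lemma colourable_colour_class:
  assumes "proper_colouring V E c" "\<And>u v. u \<in> W \<Longrightarrow> v \<in> W \<Longrightarrow> c u = c v" "W \<subseteq> V"
  shows "colourable 1 W E"
  unfolding colourable_def
  by (rule exI[of _ "\<lambda>_. 0"]) (use assms in \<open>fastforce simp: proper_colouring_def\<close>)

text \<open>Adding \<open>v\<close> to a clique in its neighbourhood gives a larger clique. As
  \<open>E\<close> is arbitrary here, \<open>{v} \<notin> E\<close> is what keeps \<open>v\<close>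
  out of its own neighbourhood.\<close>

lemma clique_free_neighbourhood:
  assumes "clique_free (Suc r) V E" "v \<in> V" "{v} \<notin> E" "finite V"
  shows "clique_free r {u \<in> V. {v, u} \<in> E} E"
  unfolding clique_free_def
proof
  assume "\<exists>K\<subseteq>{u \<in> V. {v, u} \<in> E}. card K = r \<and> clique K E"
  then obtain K where K: "K \<subseteq> {u \<in> V. {v, u} \<in> E}" "card K = r" "clique K E"
    by blast
  have "v \<notin> K" using K(1) assms(3) by auto
  moreover have "finite K" using K(1) assms(4) by (rule_tac finite_subset) auto
  ultimately have "card (insert v K) = Suc r" using K(2) by simp
  moreover have "clique (insert v K) E"
    using K(1,3) by (auto simp: clique_def insert_commute)
  moreover have "insert v K \<subseteq> V" using K(1) assms(2) by auto
  ultimately show False using assms(1) unfolding clique_free_def by blast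
qed

lemma ex_max_rainbow_indep:
  assumes "finite V"
  obtains S where "S \<subseteq> V" "indep S E" "rainbow c S"
    "\<And>T. T \<subseteq> V \<Longrightarrow> indep T E \<Longrightarrow> rainbow c T \<Longrightarrow> card T \<le> card S"
proof -
  let ?P = "\<lambda>S. S \<subseteq> V \<and> indep S E \<and> rainbow c S"
  have "?P {}" by (simp add: indep_def rainbow_def)
  moreover have "\<forall>S. ?P S \<longrightarrow> card S < Suc (card V)"
    using assms by (simp add: card_mono less_Suc_eq_le)
  ultimately have "\<exists>S. ?P S \<and> (\<forall>T. ?P T \<longrightarrow> card T \<le> card S)"
    by (rule ex_has_greatest_nat)
  with that show thesis by blast
qed

text \<open>Otherwise \<open>insert v S\<close> would be a larger rainbow independent set: the new
  colour of \<open>v\<close> gives both rainbowness and \<open>v \<notin> S\<close>.\<close>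

lemma max_rainbow_indep_dominates:
  assumes "finite V" "proper_colouring V E c"
    and S: "S \<subseteq> V" "indep S E" "rainbow c S"
    and max: "\<And>T. T \<subseteq> V \<Longrightarrow> indep T E \<Longrightarrow> rainbow c T \<Longrightarrow> card T \<le> card S"
    and v: "v \<in> V" "c v \<notin> c ` S"
  shows "\<exists>s\<in>S. {s, v} \<in> E"
proof (rule ccontr)
  assume "\<not> (\<exists>s\<in>S. {s, v} \<in> E)"
  then have "indep (insert v S) E"
    using S(2) by (auto simp: indep_def insert_commute)
  moreover have "rainbow c (insert v S)"
    using S(3) v(2) by (auto simp: rainbow_def)
  ultimately have "card (insert v S) \<le> card S"
    using max S(1) v(1) by simp
  moreover have "finite S" "v \<notin> S"
    using S(1) assms(1) v(2) finite_subset by auto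
  ultimately show False by simp
qed

text \<open>Induction on \<open>s\<close> with \<open>c\<close> and \<open>t\<close> fixed and
  \<open>V\<close> varying: since \<open>t\<close> is only an upper bound, it is inherited by every
  subset of \<open>V\<close>. The offset 2 starts the induction at edgeless graphs, where one colour
  suffices.\<close>

lemma colourable_rainbow_bound:
  assumes "finite V" "proper_colouring V E c" "clique_free (s + 2) V E"
    and "\<And>S. S \<subseteq> V \<Longrightarrow> indep S E \<Longrightarrow> rainbow c S \<Longrightarrow> card S \<le> t"
  shows "colourable ((2 * t) ^ s) V E"
  using assms
proof (induction s arbitrary: V)
  case 0
  have "{u, v} \<notin> E" if "u \<in> V" "v \<in> V" for u v
  proof
    assume uv: "{u, v} \<in> E"
    with 0 that have "u \<noteq> v" by (auto simp: proper_colouring_def)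
    then have "card {u, v} = 2" "clique {u, v} E"
      using uv by (auto simp: clique_def insert_commute)
    with that 0(3) show False by (auto simp: clique_free_def)
  qed
  then show ?case
    by (auto simp: colourable_def proper_colouring_def)
next
  case (Suc s)
  let ?m = "(2 * t) ^ s"
  let ?N = "\<lambda>v. {u \<in> V. {v, u} \<in> E}" and ?C = "\<lambda>v. {u \<in> V. c u = c v}"
  obtain S where S: "S \<subseteq> V" "indep S E" "rainbow c S"
    and max: "\<And>T. T \<subseteq> V \<Longrightarrow> indep T E \<Longrightarrow> rainbow c T \<Longrightarrow> card T \<le> card S"
    using ex_max_rainbow_indep[OF Suc.prems(1)] by metis
  have finS: "finite S" using S(1) Suc.prems(1) finite_subset by blast
  \<comment> \<open>A vertex whose colour occurs on \<open>S\<close> lies in some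
    \<open>?C v\<close>; any other is adjacent to a vertex of \<open>S\<close> by
    maximality.\<close>
  have cover: "V \<subseteq> (\<Union>v\<in>S. ?C v) \<union> (\<Union>v\<in>S. ?N v)"
    using max_rainbow_indep_dominates[OF Suc.prems(1,2) S max] by blast
  have "colourable ?m (?N v) E" if "v \<in> S" for v
  proof (rule Suc.IH)
    have "v \<in> V" using that S(1) by blast
    \<comment> \<open>A loop \<open>{v} = {v, v}\<close> would force
      \<open>c v \<noteq> c v\<close>.\<close>
    moreover from this have "{v} \<notin> E"
      using Suc.prems(2) by (force simp: proper_colouring_def)
    ultimately show "clique_free (s + 2) (?N v) E"
      using Suc.prems(1,3) by (intro clique_free_neighbourhood) auto
    show "proper_colouring (?N v) E c"
      using Suc.prems(2) by (rule proper_colouring_subset) auto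
  qed (use Suc.prems in auto)
  then have "colourable (card S * ?m) (\<Union>v\<in>S. ?N v) E"
    by (rule colourable_UN[OF finS])
  moreover have "colourable (card S * 1) (\<Union>v\<in>S. ?C v) E"
    by (intro colourable_UN[OF finS] colourable_colour_class[OF Suc.prems(2)]) auto
  ultimately have "colourable (card S * 1 + card S * ?m) V E"
    using colourable_Un colourable_mono cover by blast
  moreover have "card S * 1 + card S * ?m \<le> (2 * t) ^ Suc s"
  \<comment> \<open>For positive \<open>t\<close>, \<open>1 \<le> ?m\<close> absorbs the single
    colour of each class into a second \<open>?m\<close>, which yields the factor 2. For
    \<open>t = 0\<close> that inequality can fail, but then \<open>card S = 0\<close>.\<close>
  proof (cases "t = 0")
    case False
    then have "1 \<le> ?m" by simp
    then have "card S * 1 + card S * ?m \<le> card S * ?m + card S * ?m"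
      by (intro add_right_mono mult_left_mono) auto
    also have "\<dots> \<le> t * ?m + t * ?m"
      using Suc.prems(4)[OF S] by (intro add_mono mult_right_mono) auto
    finally show ?thesis by simp
  qed (use Suc.prems(4)[OF S] in simp)
  ultimately show ?case
    using colourable_mono by blast
qed

theorem theorem2:
  fixes r :: nat and V :: "'a set" and E :: "'a set set" and c :: "'a \<Rightarrow> 'c"
  assumes "r \<ge> 3"
    and "simple_graph V E"
    and "clique_free r V E"
    and "proper_colouring V E c"
  shows "\<exists>S \<subseteq> V. indep S E \<and> rainbow c S \<and>
    int (card S) = \<lceil>(1 / 2) * real (chromatic_number V E) powr (1 / (real r - 2))\<rceil>"
proof -
  let ?\<chi> = "chromatic_number V E"
  let ?x = "(1 / 2) * real ?\<chi> powr (1 / (real r - 2))"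
  obtain s where r: "r = s + 2" and s: "s > 0"
    using assms(1) that[of "r - 2"] by simp
  have "finite V" using assms(2) by (simp add: simple_graph_def)
  then obtain S where S: "S \<subseteq> V" "indep S E" "rainbow c S"
    and max: "\<And>T. T \<subseteq> V \<Longrightarrow> indep T E \<Longrightarrow> rainbow c T \<Longrightarrow> card T \<le> card S"
    using ex_max_rainbow_indep by metis
  let ?t = "card S"
  have "?\<chi> \<le> (2 * ?t) ^ s"
    using colourable_rainbow_bound[OF \<open>finite V\<close> assms(4)] assms(3) max
    by (intro chromatic_number_le) (auto simp: r)
  then have "real ?\<chi> \<le> (2 * real ?t) ^ s"
    by (metis of_nat_le_iff of_nat_mult of_nat_numeral of_nat_power)
  then have "real ?\<chi> powr (1 / s) \<le> ((2 * real ?t) ^ s) powr (1 / s)"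
    by (intro powr_mono2) auto
  \<comment> \<open>\<open>powr_realpow\<close> requires a positive base, so \<open>?t = 0\<close>
    is separate; there both sides vanish because \<open>s > 0\<close>.\<close>
  also have "\<dots> = 2 * real ?t"
    using s by (cases "?t = 0") (simp_all add: powr_powr powr_mult flip: powr_realpow)
  finally have "\<lceil>?x\<rceil> \<le> int ?t"
    by (simp add: r ceiling_le_iff)
  moreover have "0 \<le> \<lceil>?x\<rceil>"
    by (smt (verit) ceiling_mono ceiling_zero powr_ge_zero zero_le_mult_iff divide_nonneg_nonneg)
  ultimately obtain k where k: "\<lceil>?x\<rceil> = int k" "k \<le> ?t"
    by (metis nonneg_int_cases of_nat_le_iff)
  \<comment> \<open>Rainbowness and independence pass to subsets, so \<open>S\<close> can be trimmed
    to exactly the required size.\<close>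
  then obtain T where "T \<subseteq> S" "card T = k"
    by (meson obtain_subset_with_card_n)
  moreover have "indep T E" "rainbow c T"
    using \<open>T \<subseteq> S\<close> S(2,3) unfolding indep_def rainbow_def by (blast, blast intro: inj_on_subset)
  ultimately show ?thesis
    using S(1) k(1) by (intro exI[of _ T]) auto
qed

end
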